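(* Let $q$ be a prime power, $n\ge1$, and let $L(x)\in\mathscr{L}_n(\mathbb{F}_{q^n})$ be a linearized polynomial with $\operatorname{rk}L=n-1$. Let $L^\star(x)$ be its adjugate polynomial. Then $\operatorname{rk}L^\star=1$. Furthermore, \[\ker L^\star=\operatorname{Im}L,\qquad \operatorname{Im}L^\star=\ker L,\] where $\ker$ and $\operatorname{Im}$ denote the kernels and images of the $\mathbb{F}_q$-linear transformations of $\mathbb{F}_{q^n}$ induced by the linearized polynomials.
   Context: $\mathscr{L}_n(\mathbb{F}_{q^n})$ is the set of linearized polynomials $L(x)=\sum_{i=0}^{n-1}a_ix^{q^i}\in\mathbb{F}_{q^n}[x]/(x^{q^n}-x)$, $a_i\in\mathbb{F}_{q^n}$; each induces an $\mathbb{F}_q$-linear map of $\mathbb{F}_{q^n}$, and $\operatorname{rk}L$ is the rank of this map. The Dickson matrix associated to $L$ is $D_L=\left(a_{j-i}^{q^i}\right)_{0\le i,j\le n-1}$ (subscripts reduced modulo $n$). The adjugate matrix $D_L^\star$ (transpose of the cofactor matrix) is again of the form $\left(b_{j-i}^{q^i}\right)_{0\le i,j\le n-1}$ for some $b_0,\dots,b_{n-1}\in\mathbb{F}_{q^n}$; the adjugate polynomial of $L$ is $L^\star(x)=\sum_{i=0}^{n-1}b_ix^{q^i}$, i.e. the linearized polynomial whose associated Dickson matrix is $D_L^\star$. Equivalently, $b_i$ is the $(i,0)$-th cofactor of $D_L$ (indices starting at $0$). *)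

theory Defs
  imports
    "Jordan_Normal_Form.Determinant"
    "HOL-Number_Theory.Prime_Powers"
    "HOL-Library.Cardinality"
begin

text \<open>
  The field with \<open>q ^ n\<close> elements is a type \<open>'a\<close>.  The residue classes modulo
  \<open>x ^ (q ^ n) - x\<close> are represented by their unique representatives of degree less than
  \<open>q ^ n\<close>, so the coefficient \<open>a\<^sub>i\<close> of a linearized polynomial \<open>L\<close> is \<open>coeff L (q ^ i)\<close>
  and the map induced by \<open>L\<close> is \<open>poly L\<close>.
\<close>

definition linearized_polys :: "nat \<Rightarrow> nat \<Rightarrow> 'a :: field poly set" where
  "linearized_polys q n = {L. \<exists>a. L = (\<Sum>i<n. monom (a i) (q ^ i))}"

text \<open>For \<open>i < n\<close> and \<open>j < n\<close>, \<open>(j + n - i) mod n\<close> is \<open>j - i\<close> reduced modulo \<open>n\<close>.\<close>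

definition dickson_mat :: "nat \<Rightarrow> nat \<Rightarrow> 'a :: field poly \<Rightarrow> 'a mat" where
  "dickson_mat q n L = mat n n (\<lambda>(i, j). coeff L (q ^ ((j + n - i) mod n)) ^ (q ^ i))"

text \<open>Existence and uniqueness for the following description are \<open>adjugate_poly_ex1\<close> below.\<close>

definition adjugate_poly :: "nat \<Rightarrow> nat \<Rightarrow> 'a :: field poly \<Rightarrow> 'a poly" where
  "adjugate_poly q n L =
     (THE M. M \<in> linearized_polys q n \<and> dickson_mat q n M = adj_mat (dickson_mat q n L))"

text \<open>
  The ground field is a field type \<open>'k\<close> embedded by \<open>\<phi>\<close>; a map on \<open>'a\<close> has as its rank the
  dimension of its image over \<open>'k\<close>.
\<close>

definition rank_over :: "('k :: field \<Rightarrow> 'a :: field) \<Rightarrow> ('a \<Rightarrow> 'a) \<Rightarrow> nat" where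
  "rank_over \<phi> f = vector_space.dim (\<lambda>c x. \<phi> c * x) (range f)"

lemma vector_space_embedding:
  assumes "field_hom \<phi>"
  shows "vector_space (\<lambda>c x. \<phi> c * x)"
proof -
  interpret field_hom \<phi> by fact
  show ?thesis by unfold_locales (simp_all add: hom_distribs algebra_simps)
qed

lemma comm_ring_hom_frobenius:
  fixes q n :: nat
  assumes q: "primepow q" and card: "CARD('a :: finite_field) = q ^ n"
  shows "comm_ring_hom (\<lambda>x :: 'a. x ^ q)"
proof -
  obtain p e where p: "prime p" "e > 0" "q = p ^ e"
    using q unfolding primepow_def by auto
  have "(\<Sum>x\<in>UNIV. x + 1) = (\<Sum>x\<in>UNIV. x :: 'a)"
    by (rule sum.reindex_bij_witness[of _ "\<lambda>x. x - 1" "\<lambda>x. x + 1"]) auto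
  then have "of_nat CARD('a) = (0 :: 'a)"
    by (simp add: sum.distrib)
  then have "CHAR('a) dvd p ^ (e * n)"
    unfolding of_nat_eq_0_iff_char_dvd card p(3) power_mult .
  moreover have "prime CHAR('a)"
    by (simp add: prime_CHAR_semidom finite_imp_CHAR_pos)
  ultimately have char: "CHAR('a) = p"
    using p(1) prime_dvd_power primes_dvd_imp_eq by blast
  have "(x + y) ^ q = x ^ q + y ^ q" for x y :: 'a
    using freshmans_dream'[where 'a = 'a and n = e and m = q and x = x and y = y] p char by simp
  moreover have "q > 0" using p by (simp add: prime_gt_0_nat)
  ultimately show ?thesis
    by unfold_locales (simp_all add: power_mult_distrib)
qed

lemma coeff_linearized:
  assumes "q > 1" "i < n"
  shows "coeff (\<Sum>i<n. monom (a i) (q ^ i)) (q ^ i) = (a i :: 'a :: field)"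
proof -
  have "coeff (\<Sum>i<n. monom (a i) (q ^ i)) (q ^ i) = (\<Sum>k<n. if k = i then a k else 0)"
    unfolding coeff_sum coeff_monom using assms(1) by (intro sum.cong) auto
  then show ?thesis using assms(2) by simp
qed

lemma cofactor_eq_det:
  assumes A: "A \<in> carrier_mat n n" and i: "i < n" and j: "j < n"
  shows "cofactor (A :: 'a :: comm_ring_1 mat) i j =
    det (mat n n (\<lambda>(r, c). if r = i then (if c = j then 1 else 0) else A $$ (r, c)))"
    (is "_ = det ?R")
proof -
  have "cofactor ?R i c = cofactor A i c" for c
    unfolding cofactor_def
    by (rule arg_cong[where f = "\<lambda>M. _ * det M"])
       (rule eq_matI, use A i in \<open>auto simp: mat_delete_def\<close>)
  moreover have "det ?R = (\<Sum>c<n. ?R $$ (i, c) * cofactor ?R i c)"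
    by (rule laplace_expansion_row) (use i in auto)
  ultimately have "det ?R = (\<Sum>c<n. (if c = j then 1 else 0) * cofactor A i c)"
    using i by simp
  also have "\<dots> = (\<Sum>c<n. if c = j then cofactor A i c else 0)"
    by (intro sum.cong) auto
  finally show ?thesis using j by simp
qed

lemma cofactor_permute_rows_cols:
  assumes A: "(A :: 'a :: comm_ring_1 mat) \<in> carrier_mat n n"
    and s: "s permutes {0..<n}" and i: "i < n" and j: "j < n"
  shows "cofactor (mat n n (\<lambda>(r, c). A $$ (s r, s c))) i j = cofactor A (s i) (s j)"
proof -
  have lt: "s k < n" if "k < n" for k
    using permutes_in_image[OF s, of k] that by auto
  have inj: "s k = s l \<longleftrightarrow> k = l" for k l
    using permutes_inj[OF s] by (auto dest: injD)
  let ?R = "mat n n (\<lambda>(r, c). if r = s i then (if c = s j then 1 else 0) else A $$ (r, c))"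
  let ?T = "mat n n (\<lambda>(c, r). ?R $$ (r, c))"
  let ?B = "mat n n (\<lambda>(r, c). ?R\<^sup>T $$ (s r, c))"
  have "cofactor (mat n n (\<lambda>(r, c). A $$ (s r, s c))) i j =
    det (mat n n (\<lambda>(r, c). ?B\<^sup>T $$ (s r, c)))"
    by (subst cofactor_eq_det[OF _ i j], simp, rule arg_cong[where f = det], rule eq_matI)
       (auto simp: lt inj)
  also have "\<dots> = signof s * (signof s * det ?R)"
  proof -
    have "det (mat n n (\<lambda>(r, c). ?B\<^sup>T $$ (s r, c))) = signof s * det (?B\<^sup>T)"
      by (rule det_permute_rows[OF _ s]) auto
    also have "det (?B\<^sup>T) = det ?B" by (rule det_transpose[where n = n]) auto
    also have "\<dots> = signof s * det (?R\<^sup>T)" by (rule det_permute_rows[OF _ s]) auto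
    also have "det (?R\<^sup>T) = det ?R" by (rule det_transpose[where n = n]) auto
    finally show ?thesis .
  qed
  also have "\<dots> = det ?R" by (simp add: sign_def)
  also have "\<dots> = cofactor A (s i) (s j)"
    by (rule cofactor_eq_det[OF A lt[OF i] lt[OF j], symmetric])
  finally show ?thesis .
qed

lemma (in comm_ring_hom) cofactor_hom:
  assumes A: "A \<in> carrier_mat n n" and i: "i < n" and j: "j < n"
  shows "cofactor (map_mat hom A) i j = hom (cofactor A i j)"
  unfolding cofactor_eq_det[OF A i j]
  by (subst cofactor_eq_det[of _ n], (use A i j in simp_all)[3], subst hom_det[symmetric])
     (rule arg_cong[where f = det], rule eq_matI, use A in auto)

lemma adjugate_poly_ex1:
  fixes L :: "'a :: finite_field poly"
  assumes q: "primepow q" and card: "CARD('a) = q ^ n"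
  shows "\<exists>!M. M \<in> linearized_polys q n \<and> dickson_mat q n M = adj_mat (dickson_mat q n L)"
proof -
  interpret frob: comm_ring_hom "\<lambda>x :: 'a. x ^ q"
    by (rule comm_ring_hom_frobenius[OF q card])
  have q1: "q > 1" using q by (simp add: primepow_gt_Suc_0)
  have "CARD('a) > 1"
    using card_mono[of UNIV "{0, 1 :: 'a}"] by simp
  then have n0: "n > 0" using card by (cases n) auto
  have fixed: "x ^ (q ^ n) = x" for x :: 'a
    using finite_field_power_card_eq_same[of x] card by simp
  define s where "s k = (if k < n then (k + 1) mod n else k)" for k
  have inj: "inj_on s {0..<n}"
    by (auto simp: inj_on_def s_def mod_Suc split: if_splits)
  have "s ` {0..<n} = {0..<n}"
    by (rule endo_inj_surj) (use inj in \<open>auto simp: s_def\<close>)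
  with inj have s: "s permutes {0..<n}"
    by (intro bij_imp_permutes) (auto simp: s_def bij_betw_def)
  define D where "D = dickson_mat q n L"
  have D: "D \<in> carrier_mat n n" by (simp add: D_def dickson_mat_def)
  have shift: "mat n n (\<lambda>(r, c). D $$ (s r, s c)) = map_mat (\<lambda>x. x ^ q) D"
  proof (rule eq_matI; clarsimp simp: carrier_matD[OF D])
    fix r c assume rc: "r < n" "c < n"
    have s_eq: "s k = (if Suc k = n then 0 else Suc k)" if "k < n" for k
      using that by (simp add: s_def)
    have idx: "(s c + n - s r) mod n = (c + n - r) mod n"
    proof (cases "Suc r = n")
      case True
      then have "c + n - r = Suc c" by simp
      with True rc show ?thesis by (simp add: s_eq)
    next
      case False
      then have "n - r = Suc (n - Suc r)" using rc by simp
      with False rc show ?thesis by (cases "Suc c = n") (auto simp: s_eq mod_if)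
    qed
    have "x ^ (q ^ s r) = (x ^ (q ^ r)) ^ q" for x :: 'a
    proof (cases "Suc r = n")
      case True
      have "(x ^ (q ^ r)) ^ q = x ^ (q ^ n)"
        using True by (simp flip: power_mult add: power_Suc2 mult.commute True[symmetric])
      then show ?thesis using True fixed by (simp add: s_def)
    next
      case False
      then show ?thesis using rc by (simp add: s_def power_mult[symmetric] mult.commute)
    qed
    moreover have "s r < n" "s c < n" using rc by (auto simp: s_def)
    ultimately show "D $$ (s r, s c) = (D $$ (r, c)) ^ q"
      using rc idx by (simp add: D_def dickson_mat_def)
  qed
  have cof_shift: "cofactor D (s i) (s j) = cofactor D i j ^ q" if "i < n" "j < n" for i j
    using cofactor_permute_rows_cols[OF D s that] frob.cofactor_hom[OF D that]
    by (simp add: shift)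
  have cof: "cofactor D ((j + n - i) mod n) 0 ^ (q ^ i) = cofactor D j i" if "i < n" "j < n" for i j
    using that
  proof (induction i arbitrary: j)
    case 0
    then show ?case by simp
  next
    case (Suc i)
    define k where "k = (if j = 0 then n - 1 else j - 1)"
    have k: "k < n" "s k = j" "s i = Suc i"
      using Suc.prems by (auto simp: k_def s_def)
    have "(j + n - Suc i) mod n = (k + n - i) mod n"
      using Suc.prems by (cases "j = 0") (auto simp: k_def mod_if)
    then have "cofactor D ((j + n - Suc i) mod n) 0 ^ (q ^ Suc i)
        = (cofactor D ((k + n - i) mod n) 0 ^ (q ^ i)) ^ q"
      by (simp add: power_mult[symmetric] mult.commute)
    also have "\<dots> = cofactor D k i ^ q"
      using Suc.IH[of k] Suc.prems k by simp
    also have "\<dots> = cofactor D j (Suc i)"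
      using cof_shift[of k i] k Suc.prems by simp
    finally show ?case .
  qed
  let ?M = "\<Sum>i<n. monom (cofactor D i 0) (q ^ i)"
  have "dickson_mat q n ?M = adj_mat D"
    by (rule eq_matI)
       (use n0 D in \<open>auto simp: dickson_mat_def adj_mat_def coeff_linearized[OF q1] cof\<close>)
  moreover have "?M \<in> linearized_polys q n"
    by (auto simp: linearized_polys_def)
  moreover have "M = N" if M: "M \<in> linearized_polys q n" and N: "N \<in> linearized_polys q n"
    and eq: "dickson_mat q n M = dickson_mat q n N" for M N :: "'a poly"
  proof -
    obtain a b where ab: "M = (\<Sum>i<n. monom (a i) (q ^ i))" "N = (\<Sum>i<n. monom (b i) (q ^ i))"
      using M N by (auto simp: linearized_polys_def)
    have "a i = b i" if "i < n" for i
      using arg_cong[OF eq, of "\<lambda>A. A $$ (0, i)"] that n0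
      by (simp add: dickson_mat_def ab coeff_linearized[OF q1])
    then show ?thesis unfolding ab by (intro sum.cong) auto
  qed
  ultimately show ?thesis unfolding D_def by metis
qed

end

theory Submission
  imports Defs
begin

text \<open>
  Evaluating the polynomial \<open>L\<close> at \<open>x\<close> is the same as applying the Dickson matrix \<open>D\<close> of \<open>L\<close> to
  the vector \<open>(x, x ^ q, \<dots>, x ^ (q ^ (n - 1)))\<close>: the result is the vector built in the same way
  from \<open>L x\<close> (lemma \<open>dickson_mat_frobenius_vec\<close>).  Hence products of Dickson matrices are
  compositions of maps, and the two identities \<open>D * adj D = det D = adj D * D\<close> say that
  \<open>L (L\<^sup>\<star> x) = det D * x = L\<^sup>\<star> (L x)\<close>.  As \<open>L\<close> has rank \<open>n - 1\<close> it is not injective, so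
  \<open>det D = 0\<close> and both compositions vanish; this gives \<open>Im L \<subseteq> ker L\<^sup>\<star>\<close> and \<open>Im L\<^sup>\<star> \<subseteq> ker L\<close>.

  The heart of the matter is that \<open>L\<^sup>\<star>\<close> is not zero; its coefficient of \<open>x ^ (q ^ (n - 1))\<close> is the
  cofactor of \<open>D\<close> at position \<open>(n - 1, 0)\<close> (lemma \<open>cofactor_dickson_mat_nonzero\<close>).  If this
  cofactor vanished, a linear dependency between the rows of \<open>D\<close> other than the last one and the
  first unit vector would give \<open>w\<^sub>0, \<dots>, w\<^sub>n\<^sub>-\<^sub>2\<close> and \<open>c\<close>, not all zero, with
  \<open>c * x + (\<Sum>i<n-1. w\<^sub>i * L x ^ (q ^ i)) = 0\<close> for all \<open>x\<close>.  At a nonzero element of the kernel this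
  forces \<open>c = 0\<close>, and then a nonzero polynomial of degree at most \<open>q ^ (n - 2)\<close> has the
  \<open>q ^ (n - 1)\<close> elements of \<open>Im L\<close> as roots, which is impossible.  Having degree less than
  \<open>q ^ n\<close>, the polynomial \<open>L\<^sup>\<star>\<close> is then also nonzero as a map.

  The rest is counting.  A subspace of dimension \<open>d\<close> has \<open>q ^ d\<close> elements, so \<open>Im L\<close> has
  \<open>q ^ (n - 1)\<close> elements and \<open>ker L\<close> has \<open>q\<close>.  The image of \<open>L\<^sup>\<star>\<close> is a nonzero subspace of
  \<open>ker L\<close>, hence equal to it and of dimension one; therefore \<open>ker L\<^sup>\<star>\<close> has \<open>q ^ (n - 1)\<close> elements
  and equals \<open>Im L\<close>.
\<close>

section \<open>Counting in vector spaces over finite fields\<close>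

lemma (in vector_space) card_subspace:
  assumes field: "finite (UNIV :: 'a set)" and V: "subspace V" and fin: "finite V"
  shows "card V = CARD('a) ^ dim V"
proof -
  obtain B where B: "B \<subseteq> V" "independent B" "V \<subseteq> span B" "card B = dim V"
    by (rule basis_exists)
  have finB: "finite B" using B(1) fin by (rule finite_subset)
  have span: "span B = V" using B(1,3) V by (rule span_subspace)
  let ?g = "\<lambda>u. \<Sum>v\<in>B. u v *s v"
  have "inj_on ?g (B \<rightarrow>\<^sub>E UNIV)"
  proof (rule inj_onI)
    fix u w assume u: "u \<in> B \<rightarrow>\<^sub>E UNIV" and w: "w \<in> B \<rightarrow>\<^sub>E UNIV" and eq: "?g u = ?g w"
    have "(\<Sum>v\<in>B. (u v - w v) *s v) = 0"
      using eq by (simp add: scale_left_diff_distrib sum_subtractf)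
    then have "u v - w v = 0" if "v \<in> B" for v
      using independentD[OF B(2) finB subset_refl _ that, of "\<lambda>v. u v - w v"] by simp
    then show "u = w" using u w by (intro PiE_ext) auto
  qed
  moreover have "?g ` (B \<rightarrow>\<^sub>E UNIV) = V"
  proof -
    have "?g u \<in> ?g ` (B \<rightarrow>\<^sub>E UNIV)" for u
      by (rule image_eqI[of _ _ "restrict u B"]) (auto intro: sum.cong)
    then show ?thesis using span_finite[OF finB] span by auto
  qed
  ultimately have "card V = card (B \<rightarrow>\<^sub>E (UNIV :: 'a set))"
    using card_image by metis
  also have "\<dots> = CARD('a) ^ dim V"
    using finB B(4) by (simp add: card_PiE)
  finally show ?thesis .
qed

text \<open>Every nonempty fibre of an additive map is a translate of the kernel.\<close>

lemma card_kernel_range: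
  fixes f :: "'a :: {ab_group_add, finite} \<Rightarrow> 'b :: ab_group_add"
  assumes add: "\<And>x y. f (x + y) = f x + f y"
  shows "card {x. f x = 0} * card (range f) = CARD('a)"
proof -
  interpret additive f by unfold_locales (fact add)
  have fibre: "card {x. f x = f z} = card {x. f x = 0}" for z
    by (rule bij_betw_same_card[of "\<lambda>x. x - z"], rule bij_betw_byWitness[of _ "\<lambda>x. x + z"])
       (auto simp: diff add)
  have "CARD('a) = (\<Sum>y\<in>range f. card {x. f x = y})"
    using sum.image_gen[of UNIV "\<lambda>_. 1 :: nat" f] by simp
  also have "\<dots> = (\<Sum>y\<in>range f. card {x. f x = 0})"
    by (rule sum.cong) (auto simp: fibre)
  finally show ?thesis by (simp add: mult.commute)
qed

lemma card_range_rank_over: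
  fixes \<phi> :: "'k :: finite_field \<Rightarrow> 'a :: finite_field"
  assumes hom: "field_hom \<phi>"
    and add: "\<And>x y. f (x + y) = f x + f y"
    and scale: "\<And>c x. f (\<phi> c * x) = \<phi> c * f x"
  shows "card (range f) = CARD('k) ^ rank_over \<phi> f"
proof -
  interpret V: vector_space "\<lambda>c x. \<phi> c * x"
    by (rule vector_space_embedding[OF hom])
  have "f 0 = 0" by (rule additive.zero[OF additive.intro[OF add]])
  then have "V.subspace (range f)"
    unfolding V.subspace_def by (auto simp flip: add scale)
  then show ?thesis
    unfolding rank_over_def by (intro V.card_subspace) auto
qed

section \<open>Linearized polynomials as maps\<close>

lemma comm_ring_hom_frobenius_power:
  assumes q: "primepow q" and card: "CARD('a :: finite_field) = q ^ n"
  shows "comm_ring_hom (\<lambda>x :: 'a. x ^ (q ^ i))"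
proof (induction i)
  case 0
  show ?case by unfold_locales simp_all
next
  case (Suc i)
  interpret f: comm_ring_hom "\<lambda>x :: 'a. x ^ (q ^ i)" by fact
  interpret g: comm_ring_hom "\<lambda>x :: 'a. x ^ q"
    by (rule comm_ring_hom_frobenius[OF q card])
  have "x ^ (q ^ Suc i) = (x ^ q) ^ (q ^ i)" for x :: 'a
    by (simp add: power_mult)
  moreover have "comm_ring_hom (\<lambda>x :: 'a. (x ^ q) ^ (q ^ i))"
    by unfold_locales
       (simp_all only: f.hom_add g.hom_add f.hom_mult g.hom_mult
          f.hom_zero g.hom_zero f.hom_one g.hom_one)
  ultimately show ?case by simp
qed

lemma power_power_mod:
  assumes "CARD('a :: finite_field) = q ^ n"
  shows "(x :: 'a) ^ (q ^ (k mod n)) = x ^ (q ^ k)"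
proof -
  have "x ^ ((q ^ n) ^ m) = x" for m
    using finite_field_power_card_eq_same[of x] assms
    by (induction m) (simp_all add: power_mult)
  then have "x ^ (q ^ (n * (k div n) + k mod n)) = x ^ (q ^ (k mod n))"
    by (simp only: power_add power_mult)
  then show ?thesis by simp
qed

lemma poly_linearized:
  assumes "q > 1" and "L \<in> linearized_polys q n"
  shows "poly L x = (\<Sum>k<n. coeff L (q ^ k) * x ^ (q ^ k))"
proof -
  obtain a where a: "L = (\<Sum>i<n. monom (a i) (q ^ i))"
    using assms(2) by (auto simp: linearized_polys_def)
  have "coeff L (q ^ k) = a k" if "k < n" for k
    unfolding a by (rule coeff_linearized[OF assms(1) that])
  then show ?thesis by (simp add: a poly_sum poly_monom)
qed

lemma poly_linearized_add:
  fixes L :: "'a :: finite_field poly"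
  assumes q: "primepow q" and card: "CARD('a) = q ^ n" and L: "L \<in> linearized_polys q n"
  shows "poly L (x + y) = poly L x + poly L y"
proof -
  have "(x + y) ^ (q ^ k) = x ^ (q ^ k) + y ^ (q ^ k)" for k
  proof -
    interpret comm_ring_hom "\<lambda>x :: 'a. x ^ (q ^ k)"
      by (rule comm_ring_hom_frobenius_power[OF q card])
    show ?thesis by (rule hom_add)
  qed
  then show ?thesis
    by (simp add: poly_linearized[OF primepow_gt_Suc_0[OF q, folded One_nat_def] L]
        distrib_left sum.distrib)
qed

lemma poly_linearized_scale:
  fixes \<phi> :: "'k :: finite_field \<Rightarrow> 'a :: finite_field"
  assumes q: "q > 1" and card: "CARD('k) = q" and hom: "field_hom \<phi>"
    and L: "L \<in> linearized_polys q n"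
  shows "poly L (\<phi> c * x) = \<phi> c * poly L x"
proof -
  interpret field_hom \<phi> by fact
  have "c ^ (q ^ k) = c" for k
    using finite_field_power_card_eq_same[of c] card
    by (induction k) (simp_all add: power_mult)
  then have "\<phi> c ^ (q ^ k) = \<phi> c" for k
    by (metis hom_power)
  then show ?thesis
    by (simp add: poly_linearized[OF q L] power_mult_distrib sum_distrib_left mult.left_commute)
qed

text \<open>
  For \<open>m > 0\<close> the polynomial has degree at most \<open>q ^ (m - 1)\<close>, which is less than the number
  of roots.
\<close>

lemma linearized_coeffs_eq_0:
  fixes w :: "nat \<Rightarrow> 'a :: finite_field"
  assumes q: "q > 1" and S: "q ^ m \<le> card S"
    and roots: "\<And>x. x \<in> S \<Longrightarrow> (\<Sum>k<m. w k * x ^ (q ^ k)) = 0"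
    and k: "k < m"
  shows "w k = 0"
proof -
  let ?W = "\<Sum>k<m. monom (w k) (q ^ k)"
  have "?W = 0"
  proof (rule ccontr)
    assume W: "?W \<noteq> 0"
    have "q ^ m \<le> card S" by (fact S)
    also have "card S \<le> card {x. poly ?W x = 0}"
      using roots by (intro card_mono) (auto simp: poly_sum poly_monom)
    also have "\<dots> \<le> degree ?W" by (rule card_poly_roots_bound[OF W])
    also have "\<dots> \<le> q ^ (m - 1)"
    proof (rule degree_sum_le, simp)
      fix i assume "i \<in> {..<m}"
      then have "q ^ i \<le> q ^ (m - 1)"
        using q by (intro power_increasing) auto
      with degree_monom_le[of "w i" "q ^ i"] show "degree (monom (w i) (q ^ i)) \<le> q ^ (m - 1)"
        by (rule order_trans)
    qed
    also have "\<dots> < q ^ m" using q k by (intro power_strict_increasing) auto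
    finally show False by simp
  qed
  then show ?thesis using coeff_linearized[OF q k, of w] by simp
qed

section \<open>Dickson matrices\<close>

text \<open>
  In the sum for \<open>L x ^ (q ^ i)\<close> the term with coefficient index \<open>k\<close> contains
  \<open>x ^ (q ^ (k + i))\<close>, and by \<open>x ^ (q ^ n) = x\<close> only \<open>(k + i) mod n\<close> matters; this is the
  column in which row \<open>i\<close> of the Dickson matrix holds that coefficient.
\<close>

lemma dickson_mat_frobenius_vec:
  fixes L :: "'a :: finite_field poly"
  assumes q: "primepow q" and card: "CARD('a) = q ^ n" and L: "L \<in> linearized_polys q n"
    and i: "i < n"
  shows "(\<Sum>j<n. dickson_mat q n L $$ (i, j) * x ^ (q ^ j)) = poly L x ^ (q ^ i)"
proof -
  interpret comm_ring_hom "\<lambda>x :: 'a. x ^ (q ^ i)"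
    by (rule comm_ring_hom_frobenius_power[OF q card])
  have "poly L x ^ (q ^ i) = (\<Sum>k<n. coeff L (q ^ k) * x ^ (q ^ k)) ^ (q ^ i)"
    by (subst poly_linearized[OF primepow_gt_Suc_0[OF q, folded One_nat_def] L]) (rule refl)
  also have "\<dots> = (\<Sum>k<n. coeff L (q ^ k) ^ (q ^ i) * x ^ (q ^ ((k + i) mod n)))"
    by (simp add: hom_sum power_mult_distrib power_power_mod[OF card] power_add power_mult)
  also have "\<dots> = (\<Sum>j<n. coeff L (q ^ ((j + n - i) mod n)) ^ (q ^ i) * x ^ (q ^ j))"
  proof (rule sum.reindex_bij_witness[of _ "\<lambda>j. (j + n - i) mod n" "\<lambda>k. (k + i) mod n"])
    fix k assume "k \<in> {..<n}"
    then show "((k + i) mod n + n - i) mod n = k"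
      using i by (cases "k + i < n") (auto simp: mod_if)
    then show "coeff L (q ^ (((k + i) mod n + n - i) mod n)) ^ q ^ i * x ^ q ^ ((k + i) mod n)
      = coeff L (q ^ k) ^ q ^ i * x ^ q ^ ((k + i) mod n)"
      by simp
  next
    fix j assume "j \<in> {..<n}"
    then show "((j + n - i) mod n + i) mod n = j"
      using i by (cases "j < i") (auto simp: mod_if)
  qed (use i in auto)
  also have "\<dots> = (\<Sum>j<n. dickson_mat q n L $$ (i, j) * x ^ (q ^ j))"
    using i by (simp add: dickson_mat_def)
  finally show ?thesis by simp
qed

lemma poly_compose_dickson_mat:
  fixes L M :: "'a :: finite_field poly"
  assumes q: "primepow q" and card: "CARD('a) = q ^ n" and n: "n > 0"
    and L: "L \<in> linearized_polys q n" and M: "M \<in> linearized_polys q n"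
  shows "poly M (poly L x) =
    (\<Sum>j<n. (dickson_mat q n M * dickson_mat q n L) $$ (0, j) * x ^ (q ^ j))"
proof -
  let ?A = "dickson_mat q n M" and ?B = "dickson_mat q n L"
  have AB: "(?A * ?B) $$ (0, j) = (\<Sum>i<n. ?A $$ (0, i) * ?B $$ (i, j))" if "j < n" for j
    using that n by (simp add: dickson_mat_def scalar_prod_def atLeast0LessThan)
  have "poly M (poly L x) = (\<Sum>i<n. ?A $$ (0, i) * poly L x ^ (q ^ i))"
    using dickson_mat_frobenius_vec[OF q card M n] by simp
  also have "\<dots> = (\<Sum>i<n. \<Sum>j<n. ?A $$ (0, i) * ?B $$ (i, j) * x ^ (q ^ j))"
    by (simp add: dickson_mat_frobenius_vec[OF q card L, symmetric] sum_distrib_left mult.assoc)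
  also have "\<dots> = (\<Sum>j<n. (?A * ?B) $$ (0, j) * x ^ (q ^ j))"
    by (subst sum.swap) (simp add: AB sum_distrib_right)
  finally show ?thesis .
qed

text \<open>
  The cofactor is the determinant of the Dickson matrix with its last row replaced by the first
  unit vector.  A row vector \<open>w\<close> annihilating that matrix yields, by
  \<open>dickson_mat_frobenius_vec\<close>, the identity
  \<open>w\<^sub>n\<^sub>-\<^sub>1 * x + (\<Sum>i<n-1. w\<^sub>i * L x ^ (q ^ i)) = 0\<close>.  Choosing the last row is what keeps the
  degree in \<open>L x\<close> below the number of values of \<open>L\<close>.
\<close>

lemma cofactor_dickson_mat_nonzero:
  fixes L :: "'a :: finite_field poly"
  assumes q: "primepow q" and card: "CARD('a) = q ^ n" and n: "n > 0"
    and L: "L \<in> linearized_polys q n"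
    and image: "q ^ (n - 1) \<le> card (range (poly L))"
    and kernel: "poly L z = 0" "z \<noteq> 0"
  shows "cofactor (dickson_mat q n L) (n - 1) 0 \<noteq> 0"
proof
  have q1: "q > 1" using q by (simp add: primepow_gt_Suc_0)
  obtain m where m: "n = Suc m" using n by (cases n) auto
  define D where "D = dickson_mat q n L"
  have D: "D \<in> carrier_mat n n" by (simp add: D_def dickson_mat_def)
  define B where "B = mat n n (\<lambda>(r, c). if r = m then (if c = 0 then 1 else 0) else D $$ (r, c))"
  have B: "B \<in> carrier_mat n n" by (simp add: B_def)
  assume "cofactor (dickson_mat q n L) (n - 1) 0 = 0"
  then have "det B = 0"
    using cofactor_eq_det[OF D, of m 0] m by (simp add: B_def D_def)
  then have "det B\<^sup>T = 0" by (simp add: det_transpose[OF B])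
  then obtain w where w: "w \<in> carrier_vec n" "w \<noteq> 0\<^sub>v n" "B\<^sup>T *\<^sub>v w = 0\<^sub>v n"
    using det_0_iff_vec_prod_zero_field[of "B\<^sup>T" n] B by auto
  have col: "(\<Sum>i<n. w $ i * B $$ (i, j)) = 0" if "j < n" for j
    using arg_cong[OF w(3), of "\<lambda>v. v $ j"] that w(1) B
    by (simp add: scalar_prod_def atLeast0LessThan mult.commute)
  have rel: "(\<Sum>i<m. w $ i * poly L x ^ (q ^ i)) + w $ m * x = 0" for x
  proof -
    have row: "(\<Sum>j<n. B $$ (i, j) * x ^ (q ^ j)) = poly L x ^ (q ^ i)" if "i < m" for i
    proof -
      have "(\<Sum>j<n. B $$ (i, j) * x ^ (q ^ j)) = (\<Sum>j<n. D $$ (i, j) * x ^ (q ^ j))"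
        using that m by (intro sum.cong) (auto simp: B_def)
      also have "\<dots> = poly L x ^ (q ^ i)"
        unfolding D_def using that m by (intro dickson_mat_frobenius_vec[OF q card L]) simp
      finally show ?thesis .
    qed
    have last: "(\<Sum>j<n. B $$ (m, j) * x ^ (q ^ j)) = x"
    proof -
      have "(\<Sum>j<n. B $$ (m, j) * x ^ (q ^ j)) = (\<Sum>j<n. if j = 0 then x else 0)"
        using m by (intro sum.cong) (auto simp: B_def)
      then show ?thesis using n by simp
    qed
    have "0 = (\<Sum>j<n. (\<Sum>i<n. w $ i * B $$ (i, j)) * x ^ (q ^ j))"
      by (simp add: col)
    also have "\<dots> = (\<Sum>i<n. w $ i * (\<Sum>j<n. B $$ (i, j) * x ^ (q ^ j)))"
      unfolding sum_distrib_left sum_distrib_right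
      by (subst sum.swap) (simp add: mult.assoc)
    also have "\<dots> = (\<Sum>i<m. w $ i * (\<Sum>j<n. B $$ (i, j) * x ^ (q ^ j))) + w $ m * x"
      using last by (simp add: m)
    also have "\<dots> = (\<Sum>i<m. w $ i * poly L x ^ (q ^ i)) + w $ m * x"
      by (simp add: row)
    finally show ?thesis by simp
  qed
  have "(0 :: 'a) ^ (q ^ i) = 0" for i using q1 by simp
  then have "w $ m * z = 0"
    using rel[of z] by (simp only: kernel(1) mult_zero_right sum.neutral_const add_0_left)
  then have wm: "w $ m = 0" using kernel(2) by simp
  have "w $ i = 0" if "i < m" for i
  proof (rule linearized_coeffs_eq_0[OF q1 _ _ that, where S = "range (poly L)"])
    show "q ^ m \<le> card (range (poly L))" using image m by simp
    show "(\<Sum>k<m. w $ k * y ^ (q ^ k)) = 0" if "y \<in> range (poly L)" for y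
      using that rel wm by auto
  qed
  with wm have "w $ i = 0" if "i < n" for i
    using that m by (cases "i = m") auto
  then have "w = 0\<^sub>v n" using w(1) by (intro eq_vecI) auto
  with w(2) show False by simp
qed

section \<open>The adjugate polynomial\<close>

lemma adjugate_poly_props:
  fixes L :: "'a :: finite_field poly"
  assumes "primepow q" and "CARD('a) = q ^ n"
  shows "adjugate_poly q n L \<in> linearized_polys q n"
    and "dickson_mat q n (adjugate_poly q n L) = adj_mat (dickson_mat q n L)"
  using theI'[OF adjugate_poly_ex1[OF assms, of L]] unfolding adjugate_poly_def by auto

lemma adjugate_poly_compose:
  fixes L :: "'a :: finite_field poly"
  assumes q: "primepow q" and card: "CARD('a) = q ^ n" and n: "n > 0"
    and L: "L \<in> linearized_polys q n"
  shows "poly L (poly (adjugate_poly q n L) x) = det (dickson_mat q n L) * x"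
    and "poly (adjugate_poly q n L) (poly L x) = det (dickson_mat q n L) * x"
proof -
  let ?D = "dickson_mat q n L"
  have D: "?D \<in> carrier_mat n n" by (simp add: dickson_mat_def)
  note adj = adjugate_poly_props[OF q card, of L]
  have "(\<Sum>j<n. (d \<cdot>\<^sub>m 1\<^sub>m n) $$ (0, j) * x ^ (q ^ j)) = d * x" for d :: 'a
  proof -
    have "(\<Sum>j<n. (d \<cdot>\<^sub>m 1\<^sub>m n) $$ (0, j) * x ^ (q ^ j)) = (\<Sum>j<n. if j = 0 then d * x else 0)"
      using n by (intro sum.cong) auto
    then show ?thesis using n by simp
  qed
  then show "poly L (poly (adjugate_poly q n L) x) = det ?D * x"
    and "poly (adjugate_poly q n L) (poly L x) = det ?D * x"
    by (simp_all add: poly_compose_dickson_mat[OF q card n adj(1) L]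
        poly_compose_dickson_mat[OF q card n L adj(1)] adj(2) adj_mat(2,3)[OF D])
qed

theorem proposition4p14:
  fixes q n :: nat
    and \<phi> :: "'k :: finite_field \<Rightarrow> 'a :: finite_field"
    and L :: "'a poly"
  assumes "primepow q" and "n \<ge> 1"
    and "CARD('k) = q" and "CARD('a) = q ^ n" and "field_hom \<phi>"
    and "L \<in> linearized_polys q n"
    and "rank_over \<phi> (poly L) = n - 1"
  shows "rank_over \<phi> (poly (adjugate_poly q n L)) = 1 \<and>
    {x. poly (adjugate_poly q n L) x = 0} = range (poly L) \<and>
    range (poly (adjugate_poly q n L)) = {x. poly L x = 0}"
proof -
  note q = assms(1) and card = assms(4) and L = assms(6)
  have n: "n > 0" and q1: "q > 1" using assms(1,2) by (simp_all add: primepow_gt_Suc_0)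
  define M where "M = adjugate_poly q n L"
  note adj = adjugate_poly_props[OF q card, of L, folded M_def]
  note comp = adjugate_poly_compose[OF q card n L, folded M_def]

  have card_range: "card (range (poly N)) = q ^ rank_over \<phi> (poly N)"
    and kernel_range: "card {x. poly N x = 0} * card (range (poly N)) = q ^ n"
    if N: "N \<in> linearized_polys q n" for N :: "'a poly"
    using card_range_rank_over[OF assms(5) poly_linearized_add[OF q card N]
        poly_linearized_scale[OF q1 assms(3,5) N]]
      card_kernel_range[of "poly N", OF poly_linearized_add[OF q card N]] assms(3) card
    by auto
  have qn: "q ^ n = q * q ^ (n - 1)" using n by (cases n) auto
  have image_L: "card (range (poly L)) = q ^ (n - 1)"
    using card_range[OF L] assms(7) by simp
  then have kernel_L: "card {x. poly L x = 0} = q"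
    using kernel_range[OF L] qn q1 by simp
  have "\<not> {x. poly L x = 0} \<subseteq> {0}"
    using card_mono[of "{0}" "{x. poly L x = 0}"] kernel_L q1 by auto
  then obtain z where z: "poly L z = 0" "z \<noteq> 0" by auto

  have "poly M 0 = 0"
    by (rule additive.zero[OF additive.intro[OF poly_linearized_add[OF q card adj(1)]]])
  then have "det (dickson_mat q n L) = 0"
    using comp(2)[of z] z by simp
  then have L_after_M: "poly L (poly M x) = 0" and M_after_L: "poly M (poly L x) = 0" for x
    using comp by simp_all

  have "coeff M (q ^ (n - 1)) = cofactor (dickson_mat q n L) (n - 1) 0"
    using arg_cong[OF adj(2), of "\<lambda>A. A $$ (0, n - 1)"] n
    by (simp add: dickson_mat_def adj_mat_def)
  then have coeff: "coeff M (q ^ (n - 1)) \<noteq> 0"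
    using cofactor_dickson_mat_nonzero[OF q card n L _ z] image_L by simp
  have "\<exists>x. poly M x \<noteq> 0"
  proof (rule ccontr)
    assume "\<nexists>x. poly M x \<noteq> 0"
    then have "coeff M (q ^ (n - 1)) = 0"
      using n card
      by (intro linearized_coeffs_eq_0[OF q1, where S = UNIV and w = "\<lambda>k. coeff M (q ^ k)"])
         (auto simp flip: poly_linearized[OF q1 adj(1)])
    with coeff show False by simp
  qed
  then obtain x where x: "poly M x \<noteq> 0" ..

  have sub: "range (poly M) \<subseteq> {x. poly L x = 0}" using L_after_M by auto
  have "rank_over \<phi> (poly M) \<noteq> 0"
  proof
    assume "rank_over \<phi> (poly M) = 0"
    then have "card (range (poly M)) = 1" using card_range[OF adj(1)] by simp
    then show False
      using x \<open>poly M 0 = 0\<close> by (metis card_1_singletonE rangeI singletonD)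
  qed
  moreover have "q ^ rank_over \<phi> (poly M) \<le> q ^ 1"
    using card_mono[OF _ sub] card_range[OF adj(1)] kernel_L by simp
  then have "rank_over \<phi> (poly M) \<le> 1" using q1 power_le_imp_le_exp by blast
  ultimately have rank: "rank_over \<phi> (poly M) = 1" by simp
  then have image_M: "card (range (poly M)) = q" using card_range[OF adj(1)] by simp
  have image: "range (poly M) = {x. poly L x = 0}"
    using card_subset_eq[OF _ sub] image_M kernel_L by simp
  have "card {x. poly M x = 0} = q ^ (n - 1)"
    using kernel_range[OF adj(1)] image_M qn q1 by (simp add: mult.commute)
  moreover have "range (poly L) \<subseteq> {x. poly M x = 0}" using M_after_L by auto
  ultimately have "range (poly L) = {x. poly M x = 0}"
    using card_subset_eq[of "{x. poly M x = 0}" "range (poly L)"] image_L by simp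
  with rank image show ?thesis unfolding M_def by simp
qed

end
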